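(* Let $r \geq 1$ be an odd integer and let $G$ be a graph. If $(T,\delta)$ is a branch decomposition of $G$ with $\mathrm{simw}_G(T,\delta) = w$, then $(T,\delta)$ is also a branch decomposition of $G^r$ and $\mathrm{simw}_{G^r}(T,\delta) \leq w$. In particular, $\mathrm{simw}(G^r) \leq \mathrm{simw}(G)$ for every odd integer $r \geq 1$.
   Context: All graphs are finite and simple. The $r$-th power $G^r$ of $G$ has vertex set $V(G)$, two distinct vertices adjacent iff their distance in $G$ is at most $r$. A branch decomposition of $G$ is a pair $(T,\delta)$ where $T$ is a tree with maximum degree at most $3$ and $\delta$ is a bijection from $V(G)$ to the leaves of $T$; each edge $e$ of $T$ induces a bipartition $(A_e,\overline{A_e})$ of $V(G)$. For $X\subseteq V(G)$, $\mathrm{cutsim}_G(X)$ is the maximum size of a matching $\{x_1y_1,\dots,x_ky_k\}$ of $G$ with $x_i\in X$, $y_i\in V(G)\setminus X$, which is an induced matching of $G$. $\mathrm{simw}_G(T,\delta)=\max_{e\in E(T)}\mathrm{cutsim}_G(A_e)$, and $\mathrm{simw}(G)$ is the minimum of this over all branch decompositions of $G$ ($0$ if $|V(G)|\le1$). *)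

theory Defs
  imports "Graph_Theory.Digraph_Component" "Graph_Theory.Shortest_Path"
begin

text \<open>
  Finite simple graphs are the \<open>pair_graph\<close>s of the library: an undirected edge \<open>{u, v}\<close>
  is the pair of arcs \<open>(u, v)\<close> and \<open>(v, u)\<close>.
\<close>

definition gdist :: "'a pair_pre_digraph \<Rightarrow> 'a \<Rightarrow> 'a \<Rightarrow> ereal" where
  "gdist G u v = wf_digraph.\<mu> (with_proj G) (\<lambda>_. 1) u v"

definition graph_power :: "'a pair_pre_digraph \<Rightarrow> nat \<Rightarrow> 'a pair_pre_digraph" where
  "graph_power G r = \<lparr> pverts = pverts G,
     parcs = {(u, v). u \<in> pverts G \<and> v \<in> pverts G \<and> u \<noteq> v \<and> gdist G u v \<le> ereal (real r)} \<rparr>"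

lemma pair_graph_graph_power:
  assumes "pair_graph G"
  shows "pair_graph (graph_power G r)"
proof -
  interpret pair_graph G by fact
  have s: "gdist G u v \<le> gdist G v u" for u v
  proof -
    have "gdist G u v \<le> ereal (awalk_cost (\<lambda>_. 1) p)" if "awalk v p u" for p
    proof -
      have "awalk u (rev_path p) v" using that by (rule awalk_rev_path')
      moreover have "awalk_cost (\<lambda>_. 1) (rev_path p) = awalk_cost (\<lambda>_. 1) p"
        by (induct p) auto
      ultimately show ?thesis unfolding gdist_def using min_cost_le_walk_cost by metis
    qed
    then show ?thesis unfolding gdist_def[of G v u] \<mu>_def by (auto intro: INF_greatest)
  qed
  show ?thesis
  proof (unfold_locales, goal_cases)
    case 4 then show ?case
      by (rule finite_subset[of _ "pverts G \<times> pverts G"]) (auto simp: graph_power_def)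
  next
    case 6 then show ?case
      using s by (auto simp: graph_power_def symmetric_def intro!: symI intro: order_trans)
  qed (auto simp: graph_power_def)
qed

text \<open>
  The library constants \<open>tree\<close> and \<open>forest\<close> are unsuitable here: in a symmetric digraph every
  edge gives a cycle \<open>(u, v), (v, u)\<close> in the sense of \<open>pre_digraph.cycle\<close>. The cycles of the
  undirected graph are those of length at least 3.
\<close>

definition undirected_tree :: "'b pair_pre_digraph \<Rightarrow> bool" where
  "undirected_tree T \<longleftrightarrow> pair_graph T \<and> Digraph_Component.connected (with_proj T) \<and>
     \<not> (\<exists>p. pre_digraph.cycle (with_proj T) p \<and> 3 \<le> length p)"

definition degree :: "'b pair_pre_digraph \<Rightarrow> 'b \<Rightarrow> nat" where
  "degree T t = out_degree (with_proj T) t"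

definition leaves :: "'b pair_pre_digraph \<Rightarrow> 'b set" where
  "leaves T = {t \<in> pverts T. degree T t = 1}"

definition branch_decomposition ::
    "'a pair_pre_digraph \<Rightarrow> 'b pair_pre_digraph \<Rightarrow> ('a \<Rightarrow> 'b) \<Rightarrow> bool" where
  "branch_decomposition G T \<delta> \<longleftrightarrow> undirected_tree T \<and> (\<forall>t \<in> pverts T. degree T t \<le> 3) \<and>
     bij_betw \<delta> (pverts G) (leaves T)"

definition del_edge :: "'b pair_pre_digraph \<Rightarrow> 'b \<times> 'b \<Rightarrow> 'b pair_pre_digraph" where
  "del_edge T e = T \<lparr> parcs := parcs T - {e, prod.swap e} \<rparr>"

text \<open>
  For an edge \<open>e = (s, t)\<close> of \<open>T\<close>, the part of the induced bipartition of the vertices of \<open>G\<close>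
  that lies on the side of \<open>s\<close>; the other part is the one obtained from \<open>(t, s)\<close>.
\<close>

definition edge_part ::
    "'a pair_pre_digraph \<Rightarrow> 'b pair_pre_digraph \<Rightarrow> ('a \<Rightarrow> 'b) \<Rightarrow> 'b \<times> 'b \<Rightarrow> 'a set" where
  "edge_part G T \<delta> e = {v \<in> pverts G. fst e \<rightarrow>\<^sup>*\<^bsub>with_proj (del_edge T e)\<^esub> \<delta> v}"

text \<open>
  A matching contains exactly one of the two arcs of each of its edges (the disjointness condition
  rules out both), so \<open>card\<close> counts edges.
\<close>

definition matching :: "'a pair_pre_digraph \<Rightarrow> ('a \<times> 'a) set \<Rightarrow> bool" where
  "matching G M \<longleftrightarrow> M \<subseteq> parcs G \<and>
     (\<forall>e \<in> M. \<forall>f \<in> M. e \<noteq> f \<longrightarrow> {fst e, snd e} \<inter> {fst f, snd f} = {})"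

definition induced_matching :: "'a pair_pre_digraph \<Rightarrow> ('a \<times> 'a) set \<Rightarrow> bool" where
  "induced_matching G M \<longleftrightarrow> matching G M \<and>
     (\<forall>(u, v) \<in> parcs G. u \<in> fst ` M \<union> snd ` M \<and> v \<in> fst ` M \<union> snd ` M
        \<longrightarrow> (u, v) \<in> M \<or> (v, u) \<in> M)"

definition cutsim :: "'a pair_pre_digraph \<Rightarrow> 'a set \<Rightarrow> nat" where
  "cutsim G X = Max {card M | M. induced_matching G M \<and> M \<subseteq> X \<times> (pverts G - X)}"

text \<open>
  The maximum runs over both orientations of every edge, that is, over both parts of each
  bipartition; \<open>cutsim\<close> is the same for the two. Inserting 0 gives the value 0 to a tree
  without edges.
\<close>

definition simw_decomp ::
    "'a pair_pre_digraph \<Rightarrow> 'b pair_pre_digraph \<Rightarrow> ('a \<Rightarrow> 'b) \<Rightarrow> nat" where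
  "simw_decomp G T \<delta> = Max (insert 0 ((\<lambda>e. cutsim G (edge_part G T \<delta> e)) ` parcs T))"

text \<open>
  Every finite tree is isomorphic to one with vertices in \<open>nat\<close>, so it suffices to
  minimise over those.
\<close>

definition simw :: "'a pair_pre_digraph \<Rightarrow> nat" where
  "simw G = (if card (pverts G) \<le> 1 then 0
     else LEAST k. \<exists>(T :: nat pair_pre_digraph) \<delta>.
            branch_decomposition G T \<delta> \<and> simw_decomp G T \<delta> = k)"

end

theory Submission
  imports Defs
begin

text \<open>
  Replace every edge \<open>x y\<close> of an induced matching of \<open>G\<^sup>r\<close> across the cut by an edge \<open>a b\<close> of
  \<open>G\<close> across the cut that lies on a walk of length at most \<open>r\<close> from \<open>x\<close> to \<open>y\<close>. If two of the
  new edges met or were joined by an edge of \<open>G\<close>, at \<open>s\<close> and \<open>s'\<close> say, then \<open>d x s + d s y \<le> r\<close>,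
  \<open>d x' s' + d s' y' \<le> r\<close>, while each of \<open>d x s\<close>, \<open>d s y\<close> plus each of \<open>d x' s'\<close>, \<open>d s' y'\<close> is at
  least \<open>r\<close>, because the old edges are at distance more than \<open>r\<close>. Hence all these numbers are \<open>r / 2\<close>,
  and \<open>r\<close> is even.
\<close>

section \<open>Powers of a graph and walks\<close>

text \<open>Trades the extended-real distance for powers of the arc relation, so that later
  arguments only compose walks and count steps.\<close>

lemma graph_power_arc_iff:
  assumes "pair_graph G"
  shows "(u, v) \<in> parcs (graph_power G r) \<longleftrightarrow>
    u \<in> pverts G \<and> u \<noteq> v \<and> (\<exists>n\<le>r. (u, v) \<in> parcs G ^^ n)"
proof -
  interpret pair_graph G by fact
  have len: "awalk_cost (\<lambda>_. 1) p = real (length p)" for p :: "('a \<times> 'a) list"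
    by (induct p) auto
  have to_relpow: "(u, v) \<in> parcs G ^^ length p" if "awalk u p v" for p u
    using that by (induct p arbitrary: u)
      (auto simp: awalk_Cons_iff simp del: relpow.simps(2) intro: relpow_Suc_I2)
  have of_relpow: "\<exists>p. awalk u p v \<and> length p = n"
    if "(u, v) \<in> parcs G ^^ n" "u \<in> pverts G" for n u
    using that
  proof (induct n arbitrary: u)
    case 0
    then show ?case by (auto simp: awalk_Nil_iff)
  next
    case (Suc n)
    then obtain w where w: "(u, w) \<in> parcs G" "(w, v) \<in> parcs G ^^ n"
      by (meson relpow_Suc_D2)
    then obtain p where "awalk w p v" "length p = n"
      using Suc.hyps[OF w(2)] by (auto dest: in_arcsD2)
    then have "awalk u ((u, w) # p) v"
      using w by (auto simp: awalk_Cons_iff)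
    then show ?case using \<open>length p = n\<close> by (metis length_Cons)
  qed
  show ?thesis
  proof
    assume "(u, v) \<in> parcs (graph_power G r)"
    then have uv: "u \<in> pverts G" "u \<noteq> v" and d: "\<mu> (\<lambda>_. 1) u v \<le> ereal (real r)"
      by (auto simp: graph_power_def gdist_def)
    \<comment> \<open>A finite distance makes \<open>v\<close> reachable from \<open>u\<close>, and
      then the infimum is attained by a walk.\<close>
    from d have "\<mu> (\<lambda>_. 1) u v < \<infinity>" by (rule le_less_trans) simp
    then have "u \<rightarrow>\<^sup>*\<^bsub>with_proj G\<^esub> v" by (metis \<mu>_reach_conv)
    then obtain p where p: "awalk u p v" "\<mu> (\<lambda>_. 1) u v = ereal (awalk_cost (\<lambda>_. 1) p)"
      using min_cost_awalk[of u v "\<lambda>_. 1"] by (auto simp: apath_def)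
    then show "u \<in> pverts G \<and> u \<noteq> v \<and> (\<exists>n\<le>r. (u, v) \<in> parcs G ^^ n)"
      using uv d to_relpow[OF p(1)] by (auto simp: len)
  next
    assume "u \<in> pverts G \<and> u \<noteq> v \<and> (\<exists>n\<le>r. (u, v) \<in> parcs G ^^ n)"
    then obtain p where u: "u \<in> pverts G" "u \<noteq> v" and p: "awalk u p v" "length p \<le> r"
      using of_relpow by metis
    have "\<mu> (\<lambda>_. 1) u v \<le> ereal (real r)"
      using min_cost_le_walk_cost[OF p(1), of "\<lambda>_. 1"] p(2) order_trans
      unfolding len by fastforce
    then show "(u, v) \<in> parcs (graph_power G r)"
      using u awalk_last_in_verts p(1) by (auto simp: graph_power_def gdist_def)
  qed
qed

text \<open>The arc \<open>(a, b)\<close> is the first one on the walk that leaves \<open>X\<close>;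
  the induction peels off arcs at the front as long as they stay in \<open>X\<close>.\<close>

lemma relpow_crossing:
  assumes "(x, y) \<in> E ^^ n" "x \<in> X" "y \<notin> X"
  obtains p q a b where "p + q + 1 = n" "(x, a) \<in> E ^^ p" "(a, b) \<in> E" "(b, y) \<in> E ^^ q"
    "a \<in> X" "b \<notin> X"
proof -
  have "\<exists>p q a b. p + q + 1 = n \<and> (x, a) \<in> E ^^ p \<and> (a, b) \<in> E \<and> (b, y) \<in> E ^^ q \<and> a \<in> X \<and> b \<notin> X"
    using assms
  proof (induct n arbitrary: x)
    case 0
    then show ?case by auto
  next
    case (Suc n)
    then obtain z where z: "(x, z) \<in> E" "(z, y) \<in> E ^^ n"
      by (meson relpow_Suc_D2)
    show ?case
    proof (cases "z \<in> X")
      case True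
      then obtain p q a b where "p + q + 1 = n" "(z, a) \<in> E ^^ p" "(a, b) \<in> E"
        "(b, y) \<in> E ^^ q" "a \<in> X" "b \<notin> X"
        using Suc.hyps[OF z(2)] Suc.prems by blast
      then have "Suc p + q + 1 = Suc n" "(x, a) \<in> E ^^ Suc p" "(a, b) \<in> E"
        "(b, y) \<in> E ^^ q" "a \<in> X" "b \<notin> X"
        using relpow_Suc_I2[OF z(1)] by simp_all
      then show ?thesis by blast
    next
      case False
      with z Suc.prems have "0 + n + 1 = Suc n \<and> (x, x) \<in> E ^^ 0 \<and> (x, z) \<in> E
          \<and> (z, y) \<in> E ^^ n \<and> x \<in> X \<and> z \<notin> X" by auto
      then show ?thesis by blast
    qed
  qed
  then show thesis using that by blast
qed

lemma relpow_sym: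
  assumes "sym E" "(x, y) \<in> E ^^ n"
  shows "(y, x) \<in> E ^^ n"
  using assms(2)
proof (induct n arbitrary: y)
  case (Suc n)
  then obtain z where "(x, z) \<in> E ^^ n" "(z, y) \<in> E" by auto
  then show ?case using Suc.hyps assms(1) by (meson relpow_Suc_I2 symD)
qed auto

section \<open>Induced matchings across a cut\<close>

text \<open>The bound \<open>l \<le> 1\<close> handles two cases at once: \<open>l = 0\<close> when
  the new edges share a vertex, \<open>l = 1\<close> when an arc joins them.\<close>

lemma edges_on_far_walks_far:
  assumes "sym E" and "odd r"
    and far: "\<And>u v n. u \<in> {x, y} \<Longrightarrow> v \<in> {x', y'} \<Longrightarrow> (u, v) \<in> E ^^ n \<Longrightarrow> r < n"
    and e: "(x, a) \<in> E ^^ p" "(a, b) \<in> E" "(b, y) \<in> E ^^ q" "p + q + 1 \<le> r"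
    and e': "(x', a') \<in> E ^^ p'" "(a', b') \<in> E" "(b', y') \<in> E ^^ q'" "p' + q' + 1 \<le> r"
    and s: "s \<in> {a, b}" "s' \<in> {a', b'}" and l: "(s, s') \<in> E ^^ l" "l \<le> 1"
  shows False
proof -
  have tr: "(u, w) \<in> E ^^ (m + n)" if "(u, v) \<in> E ^^ m" "(v, w) \<in> E ^^ n" for u v w m n
    using that by (metis relcomp.relcompI relpow_add)
  \<comment> \<open>\<open>i\<close> counts the steps from \<open>a\<close> to \<open>s\<close>
    along the edge, and \<open>1 - i\<close> those from \<open>s\<close> to \<open>b\<close>, so the
    walk from \<open>x\<close> to \<open>y\<close> through \<open>s\<close> keeps length
    \<open>p + q + 1\<close>.\<close>
  define i where "i = (if s = a then 0 else 1 :: nat)"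
  define i' where "i' = (if s' = a' then 0 else 1 :: nat)"
  note sw = relpow_sym[OF assms(1)]
  have relpow_1I: "(u, v) \<in> E ^^ 1" if "(u, v) \<in> E" for u v
    using that unfolding relpow_1 .
  note ab = relpow_1I[OF e(2)] relpow_1I[OF e'(2)]
  have xs: "(x, s) \<in> E ^^ (p + i)"
    using s(1) e(1) tr[OF e(1) ab(1)] unfolding i_def by (cases "s = a") simp_all
  have ys: "(y, s) \<in> E ^^ (q + (1 - i))"
    using s(1) sw[OF e(3)] tr[OF sw[OF e(3)] sw[OF ab(1)]] unfolding i_def
    by (cases "s = a") simp_all
  have xs': "(x', s') \<in> E ^^ (p' + i')"
    using s(2) e'(1) tr[OF e'(1) ab(2)] unfolding i'_def by (cases "s' = a'") simp_all
  have ys': "(y', s') \<in> E ^^ (q' + (1 - i'))"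
    using s(2) sw[OF e'(3)] tr[OF sw[OF e'(3)] sw[OF ab(2)]] unfolding i'_def
    by (cases "s' = a'") simp_all
  \<comment> \<open>One inequality for each pair of an end in \<open>{x, y}\<close> and an end in
    \<open>{x', y'}\<close>. As \<open>l \<le> 1\<close>, each pair of walk lengths sums to at least
    \<open>r\<close>.\<close>
  have "r < p + i + l + (p' + i')" by (rule far[OF _ _ tr[OF tr[OF xs l(1)] sw[OF xs']]]) auto
  moreover have "r < p + i + l + (q' + (1 - i'))"
    by (rule far[OF _ _ tr[OF tr[OF xs l(1)] sw[OF ys']]]) auto
  moreover have "r < q + (1 - i) + l + (p' + i')"
    by (rule far[OF _ _ tr[OF tr[OF ys l(1)] sw[OF xs']]]) auto
  moreover have "r < q + (1 - i) + l + (q' + (1 - i'))"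
    by (rule far[OF _ _ tr[OF tr[OF ys l(1)] sw[OF ys']]]) auto
  moreover have "p + i + (q + (1 - i)) \<le> r" "p' + i' + (q' + (1 - i')) \<le> r"
    using e(4) e'(4) by (auto simp: i_def i'_def)
  \<comment> \<open>All four lengths together are at least \<open>2 * r\<close> by the lower bounds
    and at most \<open>2 * r\<close> by the upper ones, so every bound is tight.\<close>
  ultimately have "p + i + (p' + i') = r" "p + i + (q' + (1 - i')) = r"
    "p' + i' + (q' + (1 - i')) = r"
    using l(2) by linarith+
  then have "r = 2 * (p' + i')" by (metis add_left_cancel mult_2)
  then show False using \<open>odd r\<close> by simp
qed

text \<open>Every size of an induced matching of the power across the cut is also attained in
  \<open>G\<close>, so the maxima compare.\<close>

lemma cutsim_graph_power_le:
  assumes "pair_graph G" and "odd r"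
  shows "cutsim (graph_power G r) X \<le> cutsim G X"
proof -
  interpret pair_graph G by fact
  let ?H = "graph_power G r"
  let ?S = "\<lambda>G. {card M | M. induced_matching G M \<and> M \<subseteq> X \<times> (pverts G - X)}"
  have verts: "pverts ?H = pverts G" by (simp add: graph_power_def)
  have fin: "finite (?S K)" if "pair_graph K" for K :: "'a pair_pre_digraph"
  proof -
    interpret K: pair_graph K by fact
    have "?S K \<subseteq> card ` Pow (parcs K)" by (auto simp: induced_matching_def matching_def)
    then show ?thesis by (rule finite_subset) simp
  qed
  have sym: "sym (parcs G)" using sym_arcs by (simp add: symmetric_def)
  have larger: "\<exists>N. induced_matching G N \<and> N \<subseteq> X \<times> (pverts G - X) \<and> card N = card M"
    if M: "induced_matching ?H M" "M \<subseteq> X \<times> (pverts ?H - X)" for M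
  proof -
    have MH: "M \<subseteq> parcs ?H"
      and disj: "\<And>e f. e \<in> M \<Longrightarrow> f \<in> M \<Longrightarrow> e \<noteq> f \<Longrightarrow> {fst e, snd e} \<inter> {fst f, snd f} = {}"
      using M(1) unfolding induced_matching_def matching_def by blast+
    \<comment> \<open>\<open>P e f\<close>: the arc \<open>f\<close> of \<open>G\<close> crosses the
      cut in the same direction as \<open>e\<close> and lies on a walk of length at most
      \<open>r\<close> between the ends of \<open>e\<close>.\<close>
    define P where "P e f \<longleftrightarrow> (\<exists>p q. p + q + 1 \<le> r \<and> (fst e, fst f) \<in> parcs G ^^ p
      \<and> f \<in> parcs G \<and> (snd f, snd e) \<in> parcs G ^^ q \<and> fst f \<in> X \<and> snd f \<notin> X)" for e f
    have "\<exists>f. P e f" if e: "e \<in> M" for e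
    proof -
      obtain n where n: "n \<le> r" "(fst e, snd e) \<in> parcs G ^^ n"
        using subsetD[OF MH e] graph_power_arc_iff[OF assms(1), of "fst e" "snd e" r]
        unfolding prod.collapse by blast
      have "fst e \<in> X" "snd e \<notin> X" using e M(2) by auto
      from relpow_crossing[OF n(2) this] obtain p q a b where
        "p + q + 1 = n" "(fst e, a) \<in> parcs G ^^ p" "(a, b) \<in> parcs G"
        "(b, snd e) \<in> parcs G ^^ q" "a \<in> X" "b \<notin> X" .
      with n(1) have "P e (a, b)" unfolding P_def by auto
      then show ?thesis by blast
    qed
    then obtain f where f: "\<And>e. e \<in> M \<Longrightarrow> P e (f e)" by metis
    have sep: False if "e \<in> M" "e' \<in> M" "e \<noteq> e'" "s \<in> {fst (f e), snd (f e)}"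
      "s' \<in> {fst (f e'), snd (f e')}" "(s, s') \<in> parcs G ^^ l" "l \<le> 1" for e e' s s' l
    proof -
      \<comment> \<open>A short walk would make \<open>u\<close> and \<open>v\<close> adjacent in
        the power; inducedness then yields an edge of \<open>M\<close> meeting both \<open>e\<close>
        and \<open>e'\<close>.\<close>
      have far: "r < n" if uv: "u \<in> {fst e, snd e}" "v \<in> {fst e', snd e'}"
        "(u, v) \<in> parcs G ^^ n" for u v n
      proof (rule ccontr)
        assume "\<not> r < n"
        moreover have "u \<noteq> v" using disj[OF \<open>e \<in> M\<close> \<open>e' \<in> M\<close> \<open>e \<noteq> e'\<close>] uv by auto
        moreover have "u \<in> pverts G"
          using \<open>e \<in> M\<close> MH uv(1) by (force simp: graph_power_def)
        ultimately have "(u, v) \<in> parcs ?H"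
          using uv(3) unfolding graph_power_arc_iff[OF assms(1)] by (meson not_less)
        moreover have "u \<in> fst ` M \<union> snd ` M" "v \<in> fst ` M \<union> snd ` M"
          using uv \<open>e \<in> M\<close> \<open>e' \<in> M\<close> by auto
        ultimately have "(u, v) \<in> M \<or> (v, u) \<in> M"
          using M(1) unfolding induced_matching_def by blast
        then obtain g where g: "g \<in> M" "u \<in> {fst g, snd g}" "v \<in> {fst g, snd g}"
          by (metis fst_conv snd_conv insertCI)
        have "g = e" using disj[OF g(1) \<open>e \<in> M\<close>] g uv by blast
        moreover have "g = e'" using disj[OF g(1) \<open>e' \<in> M\<close>] g uv by blast
        ultimately show False using \<open>e \<noteq> e'\<close> by simp
      qed
      obtain p q where 1: "p + q + 1 \<le> r" "(fst e, fst (f e)) \<in> parcs G ^^ p"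
        "(fst (f e), snd (f e)) \<in> parcs G" "(snd (f e), snd e) \<in> parcs G ^^ q"
        using f[OF \<open>e \<in> M\<close>] unfolding P_def by auto
      obtain p' q' where 2: "p' + q' + 1 \<le> r" "(fst e', fst (f e')) \<in> parcs G ^^ p'"
        "(fst (f e'), snd (f e')) \<in> parcs G" "(snd (f e'), snd e') \<in> parcs G ^^ q'"
        using f[OF \<open>e' \<in> M\<close>] unfolding P_def by auto
      show False
        using edges_on_far_walks_far[OF sym assms(2) far 1(2-4,1) 2(2-4,1) that(4-7)] .
    qed
    have meet: "e = e'" if "e \<in> M" "e' \<in> M" "s \<in> {fst (f e), snd (f e)}"
      "s \<in> {fst (f e'), snd (f e')}" for e e' s
      using sep[of e e' s s 0] that by auto
    have inj: "inj_on f M" 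
    proof (rule inj_onI)
      fix e e' assume "e \<in> M" "e' \<in> M" "f e = f e'"
      then show "e = e'" using meet[of e e' "fst (f e)"] by simp
    qed
    have "matching G (f ` M)"
      unfolding matching_def
    proof (intro conjI ballI impI)
      show "f ` M \<subseteq> parcs G" using f unfolding P_def by blast
    next
      fix g h assume "g \<in> f ` M" "h \<in> f ` M" "g \<noteq> h"
      then obtain e e' where "e \<in> M" "e' \<in> M" "e \<noteq> e'" "g = f e" "h = f e'" by blast
      then show "{fst g, snd g} \<inter> {fst h, snd h} = {}" using meet[of e e'] by blast
    qed
    moreover have "(u, v) \<in> f ` M \<or> (v, u) \<in> f ` M"
      if uv: "(u, v) \<in> parcs G" "u \<in> fst ` f ` M \<union> snd ` f ` M" "v \<in> fst ` f ` M \<union> snd ` f ` M" for u v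
    proof -
      obtain e e' where e: "e \<in> M" "u \<in> {fst (f e), snd (f e)}"
        "e' \<in> M" "v \<in> {fst (f e'), snd (f e')}"
        using uv(2,3) by blast
      \<comment> \<open>With \<open>l = 1\<close>: both ends of the arc lie on the single edge
        \<open>f e\<close>, hence are its two distinct ends.\<close>
      have "e = e'" using sep[of e e' u v 1] e uv(1) by auto
      moreover have "u \<noteq> v" using pair_no_loops[OF uv(1)] by simp
      ultimately have "f e = (u, v) \<or> f e = (v, u)" using e(2,4)
        by (metis insertE prod.collapse singletonD)
      then show ?thesis using e(1) by (metis imageI)
    qed
    ultimately have "induced_matching G (f ` M)" unfolding induced_matching_def by blast
    moreover have "f ` M \<subseteq> X \<times> (pverts G - X)"
    proof (rule image_subsetI)
      fix e assume "e \<in> M"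
      from f[OF this] show "f e \<in> X \<times> (pverts G - X)"
        unfolding P_def mem_Times_iff by (metis DiffI in_arcsD2 prod.collapse)
    qed
    ultimately show ?thesis using card_image[OF inj] by blast
  qed
  \<comment> \<open>The empty matching keeps \<open>Max\<close> from being taken over an empty
    set.\<close>
  have "induced_matching ?H {}" by (auto simp: induced_matching_def matching_def)
  then have "?S ?H \<noteq> {}" by blast
  moreover have "?S ?H \<subseteq> ?S G"
  proof
    fix k assume "k \<in> ?S ?H"
    then obtain M where M: "induced_matching ?H M" "M \<subseteq> X \<times> (pverts ?H - X)" "k = card M"
      by blast
    from larger[OF M(1,2)] show "k \<in> ?S G" unfolding M(3) mem_Collect_eq by metis
  qed
  ultimately show ?thesis
    unfolding cutsim_def using fin[OF assms(1)] by (intro Max_mono)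
qed

section \<open>Branch decompositions and their widths\<close>

text \<open>The power has the same vertices, so each tree edge induces the same cut and the bound
  applies cut by cut.\<close>

lemma simw_decomp_graph_power_le:
  assumes "pair_graph G" and "odd r" and "finite (parcs T)"
  shows "simw_decomp (graph_power G r) T \<delta> \<le> simw_decomp G T \<delta>"
proof -
  have part: "edge_part (graph_power G r) T \<delta> = edge_part G T \<delta>"
    by (auto simp: edge_part_def graph_power_def)
  have "cutsim (graph_power G r) (edge_part G T \<delta> e) \<le> simw_decomp G T \<delta>"
    if "e \<in> parcs T" for e
  proof -
    have "cutsim G (edge_part G T \<delta> e) \<le> simw_decomp G T \<delta>"
      unfolding simw_decomp_def using assms(3) that by (intro Max_ge) auto
    with cutsim_graph_power_le[OF assms(1,2)] show ?thesis by (rule order_trans)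
  qed
  then show ?thesis
    unfolding simw_decomp_def[of "graph_power G r"] part using assms(3) by auto
qed

lemma branch_decomposition_graph_power [simp]:
  "branch_decomposition (graph_power G r) T \<delta> \<longleftrightarrow> branch_decomposition G T \<delta>"
  by (simp add: branch_decomposition_def graph_power_def)

lemma branch_decomposition_finite_parcs:
  "branch_decomposition G T \<delta> \<Longrightarrow> finite (parcs T)"
  unfolding branch_decomposition_def undirected_tree_def
  by (meson pair_fin_digraph.pair_finite_arcs pair_graph_def pair_digraph_def
      pair_fin_digraph_def pair_graph.axioms(1))

text \<open>
  If \<open>G\<close> had no branch decomposition, neither would \<open>graph_power G r\<close>, and both values would be
  the same unspecified number.
\<close>

lemma simw_graph_power_le:
  assumes "pair_graph G" and "odd r"
  shows "simw (graph_power G r) \<le> simw G"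
proof (cases "\<exists>(T :: nat pair_pre_digraph) \<delta>. branch_decomposition G T \<delta>")
  case True
  let ?Q = "\<lambda>G k. \<exists>(T :: nat pair_pre_digraph) \<delta>.
    branch_decomposition G T \<delta> \<and> simw_decomp G T \<delta> = k"
  from True have "\<exists>k. ?Q G k" by blast
  then have "?Q G (LEAST k. ?Q G k)" by (rule LeastI_ex)
  then obtain T :: "nat pair_pre_digraph" and \<delta>
    where T: "branch_decomposition G T \<delta>" "simw_decomp G T \<delta> = (LEAST k. ?Q G k)" by blast
  \<comment> \<open>An optimal decomposition of \<open>G\<close> competes in the minimum for the
    power.\<close>
  have "(LEAST k. ?Q (graph_power G r) k) \<le> simw_decomp (graph_power G r) T \<delta>"
    using T(1) by (intro Least_le) auto
  also have "\<dots> \<le> (LEAST k. ?Q G k)"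
    using simw_decomp_graph_power_le[OF assms branch_decomposition_finite_parcs[OF T(1)]] T(2)
    by metis
  \<comment> \<open>Both graphs have the same number of vertices, so either both values are 0 or
    both are the least values compared above.\<close>
  finally show ?thesis by (simp add: simw_def) (simp add: graph_power_def)
next
  case False
  then show ?thesis by (simp add: simw_def) (simp add: graph_power_def)
qed

theorem theorem1p8:
  fixes G :: "'a pair_pre_digraph" and r :: nat
  assumes "pair_graph G" and "r \<ge> 1" and "odd r"
  shows "(\<forall>(T :: 'b pair_pre_digraph) \<delta> w.
            branch_decomposition G T \<delta> \<and> simw_decomp G T \<delta> = w \<longrightarrow>
              branch_decomposition (graph_power G r) T \<delta> \<and>
              simw_decomp (graph_power G r) T \<delta> \<le> w) \<and>
         simw (graph_power G r) \<le> simw G"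
  using simw_decomp_graph_power_le[OF assms(1,3) branch_decomposition_finite_parcs]
    simw_graph_power_le[OF assms(1,3)] by auto

end
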